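(* Let $\mathcal F=\{q^nQ_m\mid n\in\mathbb Z,\ 1\le m\le\ell\}\subset\mathbf k^*$ and let $V$ be a finite dimensional representation of the cyclotomic $\ell$-Hecke algebra $H^{\mathbf Q}_{d,\mathbf Q}(q)$. Then for each $r\in\{1,\dots,d\}$, all eigenvalues of the action of $x_r$ on $V$ lie in $\mathcal F$.
   Context: Throughout, $\mathbf k$ is an algebraically closed field, $q\in\mathbf k^*$, $q\neq1$, $d,\ell\ge0$ are integers, $\mathbf Q=(Q_1,\dots,Q_\ell)\in(\mathbf k^* )^\ell$. $J^{\ell,d}\subset\{0,1\}^{\ell+d}$ is the set of tuples $\mathbf c=(c_1,\dots,c_{\ell+d})$ with exactly $\ell$ entries $1$ (red) and $d$ entries $0$ (black); $s_r$ denotes the transposition $(r,r+1)$, acting on tuples by swapping the entries $r,r+1$. For $\mathbf c\in J^{\ell,d}$ let $1_{\mathbf c}<\dots<d_{\mathbf c}$ be the positions of the black entries. **Higher level affine Hecke algebra** $H_{d,\mathbf Q}(q)$: the unital $\mathbf k$-algebra generated by $e(\mathbf c)$ ($\mathbf c\in J^{\ell,d}$), $T_r$ ($1\le r\le \ell+d-1$), $X_j,X_j'$ ($1\le j\le\ell+d$) with relations: the $e(\mathbf c)$ are orthogonal idempotents with $\sum_{\mathbf c}e(\mathbf c)=1$; $X_ie(\mathbf c)=X_i'e(\mathbf c)=0$ if $c_i=1$; $X_iX_i'e(\mathbf c)=X_i'X_ie(\mathbf c)=e(\mathbf c)$ if $c_i=0$; $X_i,X_i'$ commute with all $e(\mathbf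 c)$; $X_iX_j=X_jX_i$, $X_i'X_j'=X_j'X_i'$; $T_rT_s=T_sT_r$ if $|r-s|>1$; $T_rX_i=X_iT_r$ if $i\ne r,r+1$; $T_re(\mathbf c)=0$ if $c_r=c_{r+1}=1$; $T_re(\mathbf c)=e(s_r(\mathbf c))T_r$; $(T_rX_{r+1}-X_rT_r)e(\mathbf c)=(q-1)X_{r+1}e(\mathbf c)$ and $(T_rX_r-X_{r+1}T_r)e(\mathbf c)=-(q-1)X_{r+1}e(\mathbf c)$ if $c_r=c_{r+1}=0$, both being $0$ otherwise; $T_r^2e(\mathbf c)=(q-1)T_re(\mathbf c)+qe(\mathbf c)$ if $c_r=c_{r+1}=0$, $T_r^2e(\mathbf c)=(X_r-Q_{\sum_{j\le r+1}c_j})e(\mathbf c)$ if $c_r=0,c_{r+1}=1$, $T_r^2e(\mathbf c)=(X_{r+1}-Q_{\sum_{j\le r}c_j})e(\mathbf c)$ if $c_r=1,c_{r+1}=0$; and for $r<\ell+d-1$, $(T_rT_{r+1}T_r-T_{r+1}T_rT_{r+1})e(\mathbf c)$ equals $0$ if $c_{r+1}=0$, and $(1-q)X_{r+2}e(\mathbf c)$ if $c_{r+1}=1$, $c_r=c_{r+2}=0$. Put $x_r=\sum_{\mathbf c}X_{r_{\mathbf c}}e(\mathbf c)$ for $1\le r\le d$. The **cyclotomic $\ell$-Hecke algebra** $H^{\mathbf Q}_{d,\mathbf Q}(q)$ is the quotient of $H_{d,\mathbf Q}(q)$ by the two-sided ideal generated by all $e(\mathbf c)$ with $c_1=0$. 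*)

theory Defs
  imports
    "HOL-Combinatorics.Transposition"
    "HOL-Library.FuncSet"
    "HOL-Library.Poly_Mapping"
    "HOL-Computational_Algebra.Polynomial"
    "HOL-Algebra.Module"
    "HOL-Algebra.QuotRing"
begin

section \<open>Associative algebras given by generators and relations\<close>

text \<open>
  Words over an alphabet form the free monoid, written additively because
  \<^type>\<open>poly_mapping\<close> provides monoid algebras of additively written monoids.
  With its convolution product, \<open>'g word \<Rightarrow>\<^sub>0 'k\<close> is the free associative
  unital algebra on all of \<^typ>\<open>'g\<close>.
\<close>

datatype 'g word = Word (letters: "'g list")

instantiation word :: (type) monoid_add
begin

definition "0 = Word []"
definition "u + v = Word (letters u @ letters v)"

instance
  by standard (simp_all add: zero_word_def plus_word_def)

end

type_synonym ('g, 'k) ncpoly = "'g word \<Rightarrow>\<^sub>0 'k"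

definition ncconst :: "'k::zero \<Rightarrow> ('g, 'k) ncpoly"
  where "ncconst a = Poly_Mapping.single 0 a"

definition ncvar :: "'g \<Rightarrow> ('g, 'k::zero_neq_one) ncpoly"
  where "ncvar g = Poly_Mapping.single (Word [g]) 1"

text \<open>
  Algebras over a field type are records of type \<^typ>\<open>('k, 'a) module\<close>: a ring together with a
  scalar multiplication. The locale \<^locale>\<open>algebra\<close> of the library is not used, since it
  covers commutative algebras only.
\<close>

definition free_algebra :: "'g set \<Rightarrow> ('k::ring_1, ('g, 'k) ncpoly) module"
  where "free_algebra G =
    \<lparr>carrier = {p. \<forall>w\<in>Poly_Mapping.keys p. set (letters w) \<subseteq> G},
     mult = (*), one = 1, zero = 0, add = (+),
     smult = (\<lambda>a p. ncconst a * p)\<rparr>"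

definition quot_algebra :: "('k, 'a) module \<Rightarrow> 'a set \<Rightarrow> ('k, 'a set) module"
  where "quot_algebra A I =
    ring.extend (A Quot I) \<lparr>smult = (\<lambda>a C. \<Union>x\<in>C. I +>\<^bsub>A\<^esub> (a \<odot>\<^bsub>A\<^esub> x))\<rparr>"

text \<open>
  Note that an ideal of a unital algebra is automatically stable under scalars, so \<^const>\<open>genideal\<close>
  (the smallest two-sided ring ideal) is also the smallest two-sided algebra ideal.
\<close>

definition presented_ideal ::
    "'g set \<Rightarrow> (('g, 'k::ring_1) ncpoly \<Rightarrow> ('g, 'k) ncpoly \<Rightarrow> bool) \<Rightarrow> ('g, 'k) ncpoly set"
  where "presented_ideal G R = genideal (free_algebra G) {a - b | a b. R a b}"

definition presented_algebra ::
    "'g set \<Rightarrow> (('g, 'k::ring_1) ncpoly \<Rightarrow> ('g, 'k) ncpoly \<Rightarrow> bool)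
      \<Rightarrow> ('k, ('g, 'k) ncpoly set) module"
  where "presented_algebra G R = quot_algebra (free_algebra G) (presented_ideal G R)"


section \<open>Representations\<close>

definition End_algebra ::
    "('k::field \<Rightarrow> 'v::ab_group_add \<Rightarrow> 'v) \<Rightarrow> ('k, 'v \<Rightarrow> 'v) module"
  where "End_algebra scale =
    \<lparr>carrier = {f. Vector_Spaces.linear scale scale f},
     mult = (\<circ>), one = id, zero = (\<lambda>_. 0), add = (\<lambda>f g v. f v + g v),
     smult = (\<lambda>a f v. scale a (f v))\<rparr>"

definition representation ::
    "('k::field, 'a) module \<Rightarrow> ('k \<Rightarrow> 'v::ab_group_add \<Rightarrow> 'v) \<Rightarrow> ('a \<Rightarrow> 'v \<Rightarrow> 'v) \<Rightarrow> bool"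
  where "representation A scale \<rho> \<longleftrightarrow>
    vector_space scale \<and>
    \<rho> \<in> ring_hom A (End_algebra scale) \<and>
    (\<forall>a. \<forall>x\<in>carrier A. \<rho> (a \<odot>\<^bsub>A\<^esub> x) = a \<odot>\<^bsub>End_algebra scale\<^esub> \<rho> x)"

definition eigenvalue :: "('k \<Rightarrow> 'v::zero \<Rightarrow> 'v) \<Rightarrow> ('v \<Rightarrow> 'v) \<Rightarrow> 'k \<Rightarrow> bool"
  where "eigenvalue scale f a \<longleftrightarrow> (\<exists>v. v \<noteq> 0 \<and> f v = scale a v)"


section \<open>The higher level affine Hecke algebra\<close>

text \<open>
  Tuples are functions on \<open>{1..l + d}\<close> extended by \<^const>\<open>undefined\<close>; the entry 1 is red, 0 is black.
\<close>

definition colourings :: "nat \<Rightarrow> nat \<Rightarrow> (nat \<Rightarrow> nat) set"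
  where "colourings l d =
    {c \<in> {1..l + d} \<rightarrow>\<^sub>E {0, 1}. card {i \<in> {1..l + d}. c i = 1} = l}"

definition swap :: "nat \<Rightarrow> (nat \<Rightarrow> nat) \<Rightarrow> nat \<Rightarrow> nat"
  where "swap r c = c \<circ> transpose r (Suc r)"

text \<open>The position of the \<open>r\<close>-th black entry of \<open>c\<close>, for \<open>1 \<le> r \<le> d\<close>.\<close>

definition black_pos :: "nat \<Rightarrow> nat \<Rightarrow> (nat \<Rightarrow> nat) \<Rightarrow> nat \<Rightarrow> nat"
  where "black_pos l d c r = sorted_list_of_set {i \<in> {1..l + d}. c i = 0} ! (r - 1)"

datatype hgen = GenE "nat \<Rightarrow> nat" | GenT nat | GenX nat | GenX' nat

definition hecke_gens :: "nat \<Rightarrow> nat \<Rightarrow> hgen set"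
  where "hecke_gens l d =
    GenE ` colourings l d \<union> GenT ` {1..<l + d} \<union> GenX ` {1..l + d} \<union> GenX' ` {1..l + d}"

abbreviation hE :: "(nat \<Rightarrow> nat) \<Rightarrow> (hgen, 'k::ring_1) ncpoly" where "hE c \<equiv> ncvar (GenE c)"
abbreviation hT :: "nat \<Rightarrow> (hgen, 'k::ring_1) ncpoly" where "hT r \<equiv> ncvar (GenT r)"
abbreviation hX :: "nat \<Rightarrow> (hgen, 'k::ring_1) ncpoly" where "hX i \<equiv> ncvar (GenX i)"
abbreviation hX' :: "nat \<Rightarrow> (hgen, 'k::ring_1) ncpoly" where "hX' i \<equiv> ncvar (GenX' i)"

inductive hecke_rel ::
    "nat \<Rightarrow> nat \<Rightarrow> 'k::field \<Rightarrow> (nat \<Rightarrow> 'k) \<Rightarrow> (hgen, 'k) ncpoly \<Rightarrow> (hgen, 'k) ncpoly \<Rightarrow> bool"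
  for l d :: nat and q :: 'k and Q :: "nat \<Rightarrow> 'k"
where
  E_idem: "c \<in> colourings l d \<Longrightarrow> hecke_rel l d q Q (hE c * hE c) (hE c)"
| E_orth: "\<lbrakk>c \<in> colourings l d; c' \<in> colourings l d; c \<noteq> c'\<rbrakk>
    \<Longrightarrow> hecke_rel l d q Q (hE c * hE c') 0"
| E_sum: "hecke_rel l d q Q (\<Sum>c\<in>colourings l d. hE c) 1"
| X_red: "\<lbrakk>c \<in> colourings l d; i \<in> {1..l + d}; c i = 1\<rbrakk>
    \<Longrightarrow> hecke_rel l d q Q (hX i * hE c) 0"
| X'_red: "\<lbrakk>c \<in> colourings l d; i \<in> {1..l + d}; c i = 1\<rbrakk>
    \<Longrightarrow> hecke_rel l d q Q (hX' i * hE c) 0"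
| XX'_black: "\<lbrakk>c \<in> colourings l d; i \<in> {1..l + d}; c i = 0\<rbrakk>
    \<Longrightarrow> hecke_rel l d q Q (hX i * hX' i * hE c) (hE c)"
| X'X_black: "\<lbrakk>c \<in> colourings l d; i \<in> {1..l + d}; c i = 0\<rbrakk>
    \<Longrightarrow> hecke_rel l d q Q (hX' i * hX i * hE c) (hE c)"
| X_E: "\<lbrakk>c \<in> colourings l d; i \<in> {1..l + d}\<rbrakk>
    \<Longrightarrow> hecke_rel l d q Q (hX i * hE c) (hE c * hX i)"
| X'_E: "\<lbrakk>c \<in> colourings l d; i \<in> {1..l + d}\<rbrakk>
    \<Longrightarrow> hecke_rel l d q Q (hX' i * hE c) (hE c * hX' i)"
| X_X: "\<lbrakk>i \<in> {1..l + d}; j \<in> {1..l + d}\<rbrakk> \<Longrightarrow> hecke_rel l d q Q (hX i * hX j) (hX j * hX i)"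
| X'_X': "\<lbrakk>i \<in> {1..l + d}; j \<in> {1..l + d}\<rbrakk> \<Longrightarrow> hecke_rel l d q Q (hX' i * hX' j) (hX' j * hX' i)"
| T_T: "\<lbrakk>r \<in> {1..<l + d}; s \<in> {1..<l + d}; \<bar>int r - int s\<bar> > 1\<rbrakk>
    \<Longrightarrow> hecke_rel l d q Q (hT r * hT s) (hT s * hT r)"
| T_X: "\<lbrakk>r \<in> {1..<l + d}; i \<in> {1..l + d}; i \<noteq> r; i \<noteq> r + 1\<rbrakk>
    \<Longrightarrow> hecke_rel l d q Q (hT r * hX i) (hX i * hT r)"
| T_red: "\<lbrakk>c \<in> colourings l d; r \<in> {1..<l + d}; c r = 1; c (r + 1) = 1\<rbrakk>
    \<Longrightarrow> hecke_rel l d q Q (hT r * hE c) 0"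
| T_E: "\<lbrakk>c \<in> colourings l d; r \<in> {1..<l + d}\<rbrakk>
    \<Longrightarrow> hecke_rel l d q Q (hT r * hE c) (hE (swap r c) * hT r)"
| TX_Suc_black: "\<lbrakk>c \<in> colourings l d; r \<in> {1..<l + d}; c r = 0 \<and> c (r + 1) = 0\<rbrakk>
    \<Longrightarrow> hecke_rel l d q Q ((hT r * hX (r + 1) - hX r * hT r) * hE c)
          (ncconst (q - 1) * hX (r + 1) * hE c)"
| TX_Suc_other: "\<lbrakk>c \<in> colourings l d; r \<in> {1..<l + d}; \<not> (c r = 0 \<and> c (r + 1) = 0)\<rbrakk>
    \<Longrightarrow> hecke_rel l d q Q ((hT r * hX (r + 1) - hX r * hT r) * hE c) 0"
| TX_black: "\<lbrakk>c \<in> colourings l d; r \<in> {1..<l + d}; c r = 0 \<and> c (r + 1) = 0\<rbrakk>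
    \<Longrightarrow> hecke_rel l d q Q ((hT r * hX r - hX (r + 1) * hT r) * hE c)
          (- (ncconst (q - 1) * hX (r + 1) * hE c))"
| TX_other: "\<lbrakk>c \<in> colourings l d; r \<in> {1..<l + d}; \<not> (c r = 0 \<and> c (r + 1) = 0)\<rbrakk>
    \<Longrightarrow> hecke_rel l d q Q ((hT r * hX r - hX (r + 1) * hT r) * hE c) 0"
| T_sq_black: "\<lbrakk>c \<in> colourings l d; r \<in> {1..<l + d}; c r = 0; c (r + 1) = 0\<rbrakk>
    \<Longrightarrow> hecke_rel l d q Q (hT r ^ 2 * hE c) (ncconst (q - 1) * hT r * hE c + ncconst q * hE c)"
| T_sq_black_red: "\<lbrakk>c \<in> colourings l d; r \<in> {1..<l + d}; c r = 0; c (r + 1) = 1\<rbrakk>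
    \<Longrightarrow> hecke_rel l d q Q (hT r ^ 2 * hE c) ((hX r - ncconst (Q (\<Sum>j=1..r+1. c j))) * hE c)"
| T_sq_red_black: "\<lbrakk>c \<in> colourings l d; r \<in> {1..<l + d}; c r = 1; c (r + 1) = 0\<rbrakk>
    \<Longrightarrow> hecke_rel l d q Q (hT r ^ 2 * hE c) ((hX (r + 1) - ncconst (Q (\<Sum>j=1..r. c j))) * hE c)"
| braid_black: "\<lbrakk>c \<in> colourings l d; 1 \<le> r; r + 1 < l + d; c (r + 1) = 0\<rbrakk>
    \<Longrightarrow> hecke_rel l d q Q
          ((hT r * hT (r + 1) * hT r - hT (r + 1) * hT r * hT (r + 1)) * hE c) 0"
| braid_red: "\<lbrakk>c \<in> colourings l d; 1 \<le> r; r + 1 < l + d; c (r + 1) = 1; c r = 0; c (r + 2) = 0\<rbrakk>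
    \<Longrightarrow> hecke_rel l d q Q
          ((hT r * hT (r + 1) * hT r - hT (r + 1) * hT r * hT (r + 1)) * hE c)
          (ncconst (1 - q) * hX (r + 2) * hE c)"

definition hecke_algebra ::
    "nat \<Rightarrow> nat \<Rightarrow> 'k::field \<Rightarrow> (nat \<Rightarrow> 'k) \<Rightarrow> ('k, (hgen, 'k) ncpoly set) module"
  where "hecke_algebra l d q Q = presented_algebra (hecke_gens l d) (hecke_rel l d q Q)"

definition hecke_class ::
    "nat \<Rightarrow> nat \<Rightarrow> 'k::field \<Rightarrow> (nat \<Rightarrow> 'k) \<Rightarrow> (hgen, 'k) ncpoly \<Rightarrow> (hgen, 'k) ncpoly set"
  where "hecke_class l d q Q p =
    presented_ideal (hecke_gens l d) (hecke_rel l d q Q) +>\<^bsub>free_algebra (hecke_gens l d)\<^esub> p"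


section \<open>The cyclotomic quotient\<close>

text \<open>The condition \<open>1 \<le> l + d\<close> says that the first entry of \<open>c\<close> exists.\<close>

definition cyclotomic_ideal ::
    "nat \<Rightarrow> nat \<Rightarrow> 'k::field \<Rightarrow> (nat \<Rightarrow> 'k) \<Rightarrow> (hgen, 'k) ncpoly set set"
  where "cyclotomic_ideal l d q Q =
    genideal (hecke_algebra l d q Q)
      {hecke_class l d q Q (hE c) | c. c \<in> colourings l d \<and> 1 \<le> l + d \<and> c 1 = 0}"

definition cyclotomic_hecke_algebra ::
    "nat \<Rightarrow> nat \<Rightarrow> 'k::field \<Rightarrow> (nat \<Rightarrow> 'k) \<Rightarrow> ('k, (hgen, 'k) ncpoly set set) module"
  where "cyclotomic_hecke_algebra l d q Q =
    quot_algebra (hecke_algebra l d q Q) (cyclotomic_ideal l d q Q)"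

definition cyclotomic_class ::
    "nat \<Rightarrow> nat \<Rightarrow> 'k::field \<Rightarrow> (nat \<Rightarrow> 'k) \<Rightarrow> (hgen, 'k) ncpoly \<Rightarrow> (hgen, 'k) ncpoly set set"
  where "cyclotomic_class l d q Q p =
    cyclotomic_ideal l d q Q +>\<^bsub>hecke_algebra l d q Q\<^esub> hecke_class l d q Q p"

definition cyclotomic_x ::
    "nat \<Rightarrow> nat \<Rightarrow> 'k::field \<Rightarrow> (nat \<Rightarrow> 'k) \<Rightarrow> nat \<Rightarrow> (hgen, 'k) ncpoly set set"
  where "cyclotomic_x l d q Q r =
    cyclotomic_class l d q Q (\<Sum>c\<in>colourings l d. hX (black_pos l d c r) * hE c)"

end

theory Submission
  imports Defs
begin

text \<open>
  An eigenvector of \<open>x\<^sub>r\<close> has a nonzero component in some \<open>e(c)V\<close>, so it suffices to show, by induction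
  on the black position \<open>i\<close> of \<open>c\<close>, that the eigenvalues of \<open>X\<^sub>i\<close> on \<open>e(c)V\<close> have the form
  \<open>q\<^sup>n Q\<^sub>m\<close>. For \<open>i = 1\<close> the space \<open>e(c)V\<close> vanishes. Let \<open>X\<^sub>i v = a v\<close> and \<open>T = T\<^bsub>i-1\<^esub>\<close>. If position
  \<open>i - 1\<close> is red, then either \<open>T v\<close> is an eigenvector of \<open>X\<^bsub>i-1\<^esub>\<close> for \<open>a\<close>, or \<open>T v = 0\<close> and \<open>T\<^sup>2 v = 0\<close>
  forces \<open>a = Q\<^sub>m\<close>. If it is black, choose \<open>v\<close> to be also an eigenvector of \<open>X\<^bsub>i-1\<^esub>\<close>, with eigenvalue
  \<open>b \<noteq> a\<close>; then \<open>T v + \<lambda> v\<close> with \<open>\<lambda> = (q - 1) a / (b - a)\<close> is an eigenvector of \<open>X\<^bsub>i-1\<^esub>\<close> for \<open>a\<close>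
  unless it is zero, and in that case the quadratic relation for \<open>T\<close> gives \<open>\<lambda> = 1\<close> or \<open>\<lambda> = - q\<close>, that is,
  \<open>b = q a\<close> or \<open>a = q b\<close>.
\<close>

section \<open>Eigenvectors over an algebraically closed field\<close>

text \<open>The vector p(f) v, evaluated by Horner's scheme on the coefficients of p; the recursion
  in \<open>poly_apply_pCons\<close> then supports induction on p.\<close>

definition poly_apply :: "('k::zero \<Rightarrow> 'v::ab_group_add \<Rightarrow> 'v) \<Rightarrow> ('v \<Rightarrow> 'v) \<Rightarrow> 'k poly \<Rightarrow> 'v \<Rightarrow> 'v"
  where "poly_apply scale f p v = fold_coeffs (\<lambda>a w. scale a v + f w) p 0"

context vector_space
begin

context
  fixes f :: "'b \<Rightarrow> 'b"
  assumes f: "Vector_Spaces.linear scale scale f"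
begin

interpretation Vector_Spaces.linear scale scale f by (rule f)

lemma poly_apply_0 [simp]: "poly_apply scale f 0 v = 0"
  by (simp add: poly_apply_def)

lemma poly_apply_pCons [simp]:
  "poly_apply scale f (pCons a p) v = scale a v + f (poly_apply scale f p v)"
  \<comment> \<open>The zero polynomial has an empty coefficient list, so in that case the equation
    rests on \<open>f 0 = 0\<close>.\<close>
  by (cases "a = 0 \<and> p = 0") (auto simp: poly_apply_def zero)

lemma poly_apply_add:
  "poly_apply scale f (p + p') v = poly_apply scale f p v + poly_apply scale f p' v"
  by (induction p p' rule: poly_induct2) (auto simp: add scale_left_distrib)

lemma poly_apply_smult: "poly_apply scale f (Polynomial.smult a p) v = scale a (poly_apply scale f p v)"
  by (induction p) (auto simp: scale scale_right_distrib)

lemma poly_apply_monom: "poly_apply scale f (monom a n) v = scale a ((f ^^ n) v)"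
  by (induction n) (auto simp: monom_0 monom_Suc scale zero)

lemma poly_apply_sum:
  "poly_apply scale f (\<Sum>i\<in>S. P i) v = (\<Sum>i\<in>S. poly_apply scale f (P i) v)"
  by (induction S rule: infinite_finite_induct) (auto simp: poly_apply_add)

lemma poly_apply_linear_factor:
  "poly_apply scale f ([:- b, 1:] * p) v
    = f (poly_apply scale f p v) - scale b (poly_apply scale f p v)"
proof -
  have "[:- b, 1:] * p = pCons 0 p + Polynomial.smult (- b) p"
    by simp
  then show ?thesis
    by (simp only: poly_apply_add poly_apply_smult poly_apply_pCons) simp
qed

text \<open>Eigenvectors will be found in the form p(f) v. This keeps them inside an invariant
  subspace without restricting f to it.\<close>

lemma poly_apply_in_subspace:
  assumes "subspace W" "f ` W \<subseteq> W" "v \<in> W"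
  shows "poly_apply scale f p v \<in> W"
  using assms
  by (induction p) (auto intro!: subspace_add subspace_scale subspace_0)

end

end

text \<open>In dimension n the n + 1 iterates v, f v, ..., f^n v either are linearly dependent or
  contain a repetition; both yield a polynomial relation.\<close>

lemma (in finite_dimensional_vector_space) annihilating_polynomial:
  assumes f: "Vector_Spaces.linear scale scale f"
  obtains p where "p \<noteq> 0" "poly_apply scale f p v = 0"
proof -
  define n where "n = dim (UNIV :: 'b set)"
  define g where "g i = (f ^^ i) v" for i
  show ?thesis
  proof (cases "inj_on g {..n}")
    case True
    then have "card (g ` {..n}) > dim (g ` {..n})"
      using dim_subset[of "g ` {..n}" UNIV] by (simp add: card_image n_def)
    then have "dependent (g ` {..n})"
      by (rule dependent_biggerset_general)
    then obtain u w where w: "w \<in> g ` {..n}" "u w \<noteq> 0"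
      and sum: "(\<Sum>x\<in>g ` {..n}. scale (u x) x) = 0"
      by (auto simp: dependent_finite)
    obtain j where j: "j \<le> n" "w = g j"
      using w by auto
    define p where "p = (\<Sum>i\<le>n. monom (u (g i)) i)"
    have "coeff p j = u w"
      using j by (simp add: p_def coeff_sum)
    then have "p \<noteq> 0"
      using w by auto
    moreover have "poly_apply scale f p v = 0"
      using sum
      by (simp add: p_def poly_apply_sum[OF f] poly_apply_monom[OF f] sum.reindex[OF True]
          flip: g_def)
    ultimately show ?thesis
      by (rule that)
  next
    case False
    then obtain i j where ij: "i \<noteq> j" "g i = g j"
      by (auto simp: inj_on_def)
    \<comment> \<open>With a repetition the set of iterates has fewer than n + 1 elements, so the
      dimension count does not apply; x^i - x^j serves instead.\<close>
    define p where "p = monom (1 :: 'a) i + monom (- 1) j"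
    have "coeff p i = 1"
      using ij by (simp add: p_def)
    then have "p \<noteq> 0"
      by auto
    moreover have "poly_apply scale f p v = 0"
      using ij by (simp add: p_def poly_apply_add[OF f] poly_apply_monom[OF f] flip: g_def)
    ultimately show ?thesis
      by (rule that)
  qed
qed

text \<open>Split off a root b, p = (x - b) g. Either g(f) v is nonzero and is an eigenvector for b,
  or g annihilates v and has smaller degree. Existence of roots is a hypothesis because the scalars
  of the locale form an arbitrary field.\<close>

lemma (in vector_space) eigenvector_from_root:
  assumes f: "Vector_Spaces.linear scale scale f"
    and root: "\<And>p :: 'a poly. degree p > 0 \<Longrightarrow> \<exists>z. poly p z = 0"
    and p: "p \<noteq> 0" "poly_apply scale f p v = 0" and v: "v \<noteq> 0"
  shows "\<exists>g b. poly_apply scale f g v \<noteq> 0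
    \<and> f (poly_apply scale f g v) = scale b (poly_apply scale f g v)"
  using p
proof (induction "degree p" arbitrary: p rule: less_induct)
  case less
  interpret Vector_Spaces.linear scale scale f by (rule f)
  have "degree p \<noteq> 0"
  proof
    assume "degree p = 0"
    then obtain a where "p = [:a:]"
      using degree_eq_zeroE by blast
    then show False
      using less.prems v by (simp add: poly_apply_pCons[OF f] poly_apply_0[OF f] zero)
  qed
  then obtain b where "poly p b = 0"
    using root by blast
  then obtain g where g: "p = [:- b, 1:] * g"
    using poly_eq_0_iff_dvd by blast
  have eig: "f (poly_apply scale f g v) = scale b (poly_apply scale f g v)"
    using less.prems(2) unfolding g poly_apply_linear_factor[OF f] by simp
  have "g \<noteq> 0"
    using g less.prems(1) by auto
  then have "degree g < degree p"
    unfolding g by (subst degree_mult_eq) auto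
  then show ?case
    using less.hyps[of g] \<open>g \<noteq> 0\<close> eig by blast
qed

text \<open>With W an eigenspace of one operator and f an operator commuting with it, this produces
  joint eigenvectors.\<close>

lemma invariant_subspace_eigenvector:
  fixes scale :: "'k::alg_closed_field \<Rightarrow> 'v::ab_group_add \<Rightarrow> 'v"
  assumes "finite_dimensional_vector_space scale Basis"
    and f: "Vector_Spaces.linear scale scale f"
    and W: "module.subspace scale W" "f ` W \<subseteq> W" and v: "v \<in> W" "v \<noteq> 0"
  obtains w b where "w \<in> W" "w \<noteq> 0" "f w = scale b w"
proof -
  interpret finite_dimensional_vector_space scale Basis by fact
  obtain p where "p \<noteq> 0" "poly_apply scale f p v = 0"
    using annihilating_polynomial[OF f] .
  then obtain g b where "poly_apply scale f g v \<noteq> 0"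
      "f (poly_apply scale f g v) = scale b (poly_apply scale f g v)"
    using eigenvector_from_root[OF f _ _ _ v(2)] alg_closed_imp_poly_has_root by blast
  with poly_apply_in_subspace[OF f W v(1)] show ?thesis
    by (rule that)
qed

section \<open>Quotients of algebras\<close>

text \<open>Scalars act as left multiplication by elements a 1 of the ring. This makes ideals stable
  under scalars and is inherited by quotients.\<close>

definition unital_algebra :: "('k, 'a) module \<Rightarrow> bool"
  where "unital_algebra A \<longleftrightarrow> ring A \<and>
    (\<forall>a. a \<odot>\<^bsub>A\<^esub> \<one>\<^bsub>A\<^esub> \<in> carrier A) \<and>
    (\<forall>a. \<forall>x\<in>carrier A. a \<odot>\<^bsub>A\<^esub> x = (a \<odot>\<^bsub>A\<^esub> \<one>\<^bsub>A\<^esub>) \<otimes>\<^bsub>A\<^esub> x)"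

lemma carrier_free_algebra:
  "p \<in> carrier (free_algebra G) \<longleftrightarrow> (\<forall>w\<in>Poly_Mapping.keys p. set (letters w) \<subseteq> G)"
  by (simp add: free_algebra_def)

lemma free_algebra_simps [simp]:
  "mult (free_algebra G) = (*)" "one (free_algebra G) = 1" "zero (free_algebra G) = 0"
  "add (free_algebra G) = (+)" "smult (free_algebra G) = (\<lambda>a p. ncconst a * p)"
  by (simp_all add: free_algebra_def)

lemma free_algebra_closed [simp, intro]:
  fixes p p' :: "('g, 'k::ring_1) ncpoly"
  shows "0 \<in> carrier (free_algebra G)"
    and "1 \<in> carrier (free_algebra G)"
    and "ncconst a \<in> carrier (free_algebra G)"
    and "g \<in> G \<Longrightarrow> ncvar g \<in> carrier (free_algebra G)"
    and "p \<in> carrier (free_algebra G) \<Longrightarrow> - p \<in> carrier (free_algebra G)"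
    and "\<lbrakk>p \<in> carrier (free_algebra G); p' \<in> carrier (free_algebra G)\<rbrakk>
      \<Longrightarrow> p + p' \<in> carrier (free_algebra G)"
    and "\<lbrakk>p \<in> carrier (free_algebra G); p' \<in> carrier (free_algebra G)\<rbrakk>
      \<Longrightarrow> p - p' \<in> carrier (free_algebra G)"
    and "\<lbrakk>p \<in> carrier (free_algebra G); p' \<in> carrier (free_algebra G)\<rbrakk>
      \<Longrightarrow> p * p' \<in> carrier (free_algebra G)"
proof -
  show "0 \<in> carrier (free_algebra G)"
    and "1 \<in> carrier (free_algebra G)"
    and "ncconst a \<in> carrier (free_algebra G)"
    and "g \<in> G \<Longrightarrow> ncvar g \<in> carrier (free_algebra G)"
    and "p \<in> carrier (free_algebra G) \<Longrightarrow> - p \<in> carrier (free_algebra G)"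
    by (auto simp: carrier_free_algebra ncconst_def ncvar_def zero_word_def)
  show "\<lbrakk>p \<in> carrier (free_algebra G); p' \<in> carrier (free_algebra G)\<rbrakk>
      \<Longrightarrow> p + p' \<in> carrier (free_algebra G)"
    using keys_add[of p p'] by (fastforce simp: carrier_free_algebra)
  show "\<lbrakk>p \<in> carrier (free_algebra G); p' \<in> carrier (free_algebra G)\<rbrakk>
      \<Longrightarrow> p - p' \<in> carrier (free_algebra G)"
    using keys_diff[of p p'] by (fastforce simp: carrier_free_algebra)
  show "\<lbrakk>p \<in> carrier (free_algebra G); p' \<in> carrier (free_algebra G)\<rbrakk>
      \<Longrightarrow> p * p' \<in> carrier (free_algebra G)"
    using keys_mult[of p p'] by (fastforce simp: carrier_free_algebra plus_word_def)
qed

lemma free_algebra_sum_closed [simp, intro]: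
  "(\<And>i. i \<in> S \<Longrightarrow> P i \<in> carrier (free_algebra G)) \<Longrightarrow>
    (\<Sum>i\<in>S. P i :: ('g, 'k::ring_1) ncpoly) \<in> carrier (free_algebra G)"
  by (induction S rule: infinite_finite_induct) auto

lemma unital_algebra_free_algebra:
  "unital_algebra (free_algebra G :: ('k::ring_1, ('g, 'k) ncpoly) module)"
proof -
  have "ring (free_algebra G :: ('k::ring_1, ('g, 'k) ncpoly) module)"
  proof (rule ringI)
    show "abelian_group (free_algebra G :: ('k, ('g, 'k) ncpoly) module)"
    proof (rule abelian_groupI)
      fix p :: "('g, 'k) ncpoly" assume "p \<in> carrier (free_algebra G)"
      then show "\<exists>y\<in>carrier (free_algebra G). y \<oplus>\<^bsub>free_algebra G\<^esub> p = \<zero>\<^bsub>free_algebra G\<^esub>"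
        by (intro bexI[of _ "- p"]) auto
    qed (auto simp: algebra_simps)
    show "monoid (free_algebra G :: ('k, ('g, 'k) ncpoly) module)"
      by (rule monoidI) (auto simp: algebra_simps)
  qed (auto simp: algebra_simps)
  then show ?thesis
    by (auto simp: unital_algebra_def)
qed

lemma quot_algebra_simps [simp]:
  "carrier (quot_algebra A I) = carrier (A Quot I)" "mult (quot_algebra A I) = mult (A Quot I)"
  "one (quot_algebra A I) = one (A Quot I)" "zero (quot_algebra A I) = zero (A Quot I)"
  "add (quot_algebra A I) = add (A Quot I)"
  "smult (quot_algebra A I) = (\<lambda>a C. \<Union>x\<in>C. I +>\<^bsub>A\<^esub> (a \<odot>\<^bsub>A\<^esub> x))"
  by (simp_all add: quot_algebra_def ring.defs)

text \<open>The ring operations are those of \<open>A Quot I\<close>, but the record type differs,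
  so the axioms are transferred one by one.\<close>

lemma ring_quot_algebra:
  assumes "ideal I A"
  shows "ring (quot_algebra A I)"
proof -
  interpret Q: ring "A Quot I"
    using assms by (rule ideal.quotient_is_ring)
  show ?thesis
  proof (rule ringI)
    show "abelian_group (quot_algebra A I)"
    proof (rule abelian_groupI)
      fix x y assume "x \<in> carrier (quot_algebra A I)" "y \<in> carrier (quot_algebra A I)"
      then show "x \<oplus>\<^bsub>quot_algebra A I\<^esub> y = y \<oplus>\<^bsub>quot_algebra A I\<^esub> x"
        by (simp add: Q.a_comm)
    next
      fix x assume "x \<in> carrier (quot_algebra A I)"
      then show "\<exists>y\<in>carrier (quot_algebra A I).
          y \<oplus>\<^bsub>quot_algebra A I\<^esub> x = \<zero>\<^bsub>quot_algebra A I\<^esub>"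
        using Q.l_neg Q.a_inv_closed by fastforce
    qed (simp_all add: Q.a_assoc)
    show "monoid (quot_algebra A I)"
      by (rule monoidI) (auto simp: Q.m_assoc)
  qed (auto simp: Q.l_distr Q.r_distr)
qed

lemma coset_ring_hom:
  assumes "ideal I A"
  shows "(\<lambda>x. I +>\<^bsub>A\<^esub> x) \<in> ring_hom A (quot_algebra A I)"
  using ideal.rcos_ring_hom[OF assms] by (simp add: ring_hom_def)

text \<open>The union over all representatives collapses to one coset: if y = i + x with i in I,
  then a y and a x differ by (a 1) i, which lies in I.\<close>

lemma quot_algebra_smult_coset:
  assumes A: "unital_algebra A" and I: "ideal I A" and x: "x \<in> carrier A"
  shows "a \<odot>\<^bsub>quot_algebra A I\<^esub> (I +>\<^bsub>A\<^esub> x) = I +>\<^bsub>A\<^esub> (a \<odot>\<^bsub>A\<^esub> x)"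
proof -
  interpret ideal I A by fact
  define e where "e = a \<odot>\<^bsub>A\<^esub> \<one>\<^bsub>A\<^esub>"
  have e: "e \<in> carrier A" and smult: "\<And>y. y \<in> carrier A \<Longrightarrow> a \<odot>\<^bsub>A\<^esub> y = e \<otimes>\<^bsub>A\<^esub> y"
    using A unfolding unital_algebra_def e_def by blast+
  have "I +>\<^bsub>A\<^esub> (a \<odot>\<^bsub>A\<^esub> y) = I +>\<^bsub>A\<^esub> (a \<odot>\<^bsub>A\<^esub> x)" if "y \<in> I +>\<^bsub>A\<^esub> x" for y
  proof -
    obtain i where i: "i \<in> I" "y = i \<oplus>\<^bsub>A\<^esub> x"
      using \<open>y \<in> I +>\<^bsub>A\<^esub> x\<close> by (auto simp: a_r_coset_def')
    have iA: "i \<in> carrier A"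
      using i by (simp add: a_Hcarr)
    have "e \<otimes>\<^bsub>A\<^esub> y = e \<otimes>\<^bsub>A\<^esub> i \<oplus>\<^bsub>A\<^esub> e \<otimes>\<^bsub>A\<^esub> x"
      using i e x iA by (simp add: r_distr)
    then have "e \<otimes>\<^bsub>A\<^esub> y \<in> I +>\<^bsub>A\<^esub> (e \<otimes>\<^bsub>A\<^esub> x)"
      using I_l_closed[OF i(1) e] by (auto simp: a_r_coset_def')
    then have "I +>\<^bsub>A\<^esub> (e \<otimes>\<^bsub>A\<^esub> x) = I +>\<^bsub>A\<^esub> (e \<otimes>\<^bsub>A\<^esub> y)"
      using e x by (intro a_repr_independence) (auto simp: a_subgroup)
    then show ?thesis
      using i iA x by (simp add: smult)
  qed
  then show ?thesis
    using a_rcos_self[OF x] unfolding quot_algebra_simps by blast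
qed

text \<open>The coset map is multiplicative and respects scalars. The result allows quotients to be
  iterated, since the cyclotomic algebra is a quotient of a quotient of the free algebra.\<close>

lemma unital_algebra_quot_algebra:
  assumes A: "unital_algebra A" and I: "ideal I A"
  shows "unital_algebra (quot_algebra A I)"
proof -
  interpret ideal I A by fact
  have one: "\<one>\<^bsub>quot_algebra A I\<^esub> = I +>\<^bsub>A\<^esub> \<one>\<^bsub>A\<^esub>"
    by (simp add: FactRing_def)
  have carr: "carrier (quot_algebra A I) = (\<lambda>x. I +>\<^bsub>A\<^esub> x) ` carrier A"
    by (auto simp: FactRing_simps)
  have cl: "a \<odot>\<^bsub>A\<^esub> \<one>\<^bsub>A\<^esub> \<in> carrier A"
    and sm: "x \<in> carrier A \<Longrightarrow> a \<odot>\<^bsub>A\<^esub> x = (a \<odot>\<^bsub>A\<^esub> \<one>\<^bsub>A\<^esub>) \<otimes>\<^bsub>A\<^esub> x" for a x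
    using A unfolding unital_algebra_def by blast+
  have smult_one: "a \<odot>\<^bsub>quot_algebra A I\<^esub> (I +>\<^bsub>A\<^esub> \<one>\<^bsub>A\<^esub>) = I +>\<^bsub>A\<^esub> (a \<odot>\<^bsub>A\<^esub> \<one>\<^bsub>A\<^esub>)" for a
    by (rule quot_algebra_smult_coset[OF A I one_closed])
  have "a \<odot>\<^bsub>quot_algebra A I\<^esub> (I +>\<^bsub>A\<^esub> x)
      = (I +>\<^bsub>A\<^esub> (a \<odot>\<^bsub>A\<^esub> \<one>\<^bsub>A\<^esub>)) \<otimes>\<^bsub>quot_algebra A I\<^esub> (I +>\<^bsub>A\<^esub> x)"
    if x: "x \<in> carrier A" for a x
    unfolding quot_algebra_smult_coset[OF A I x] ring_hom_mult[OF coset_ring_hom[OF I] cl x, symmetric]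
    by (subst sm[OF x]) (rule refl)
  then show ?thesis
    unfolding unital_algebra_def one carr smult_one
    using ring_quot_algebra[OF I] cl by blast
qed

lemma coset_eq_zero_coset:
  assumes "ideal I A" and "x \<in> I"
  shows "I +>\<^bsub>A\<^esub> x = I +>\<^bsub>A\<^esub> \<zero>\<^bsub>A\<^esub>"
proof -
  interpret ideal I A by fact
  show ?thesis
    using assms a_subgroup by (simp add: a_coset_join2 a_Hcarr)
qed

section \<open>Colourings\<close>

lemma finite_colourings [simp]: "finite (colourings l d)"
  by (rule finite_subset[of _ "{1..l + d} \<rightarrow>\<^sub>E {0, 1}"])
    (auto simp: colourings_def intro!: finite_PiE)

lemma colouring_values:
  assumes "c \<in> colourings l d" "i \<in> {1..l + d}"
  shows "c i = 0 \<or> c i = 1"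
  using assms by (auto simp: colourings_def PiE_iff)

text \<open>Both r and r + 1 lie in \<open>{1..l + d}\<close>, so the transposition permutes the
  positions, maps red ones bijectively to red ones, and fixes everything outside the range.\<close>

lemma swap_in_colourings:
  assumes c: "c \<in> colourings l d" and r: "r \<in> {1..<l + d}"
  shows "swap r c \<in> colourings l d"
proof -
  define f where "f = transpose r (Suc r)"
  have f_mem: "f i \<in> {1..l + d} \<longleftrightarrow> i \<in> {1..l + d}" for i
    using r by (cases "i = r"; cases "i = Suc r") (auto simp: f_def)
  have f_f: "f (f i) = i" and swap_f: "swap r c i = c (f i)" for i
    by (simp_all add: f_def swap_def)
  have "bij_betw f {i \<in> {1..l + d}. c i = 1} {i \<in> {1..l + d}. swap r c i = 1}"
    by (rule bij_betw_byWitness[where f' = f]) (auto simp only: f_f f_mem swap_f mem_Collect_eq)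
  then have "card {i \<in> {1..l + d}. swap r c i = 1} = card {i \<in> {1..l + d}. c i = 1}"
    by (simp add: bij_betw_same_card)
  moreover have "swap r c \<in> {1..l + d} \<rightarrow>\<^sub>E {0, 1}"
    using c by (simp only: colourings_def mem_Collect_eq PiE_iff extensional_def swap_f f_mem
        ball_simps) (metis f_mem)
  ultimately show ?thesis
    using c by (simp add: colourings_def)
qed

lemma swap_same: "c r = c (Suc r) \<Longrightarrow> swap r c = c"
  by (auto simp: swap_def transpose_def)

text \<open>Of the l + d entries exactly l are red, so there are d black ones, and the zero-based
  index r - 1 falls inside the sorted list of their positions.\<close>

lemma black_pos:
  assumes c: "c \<in> colourings l d" and r: "r \<in> {1..d}"
  shows "black_pos l d c r \<in> {1..l + d}" "c (black_pos l d c r) = 0"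
proof -
  define B where "B = {i \<in> {1..l + d}. c i = 0}"
  define R where "R = {i \<in> {1..l + d}. c i = 1}"
  have "B \<union> R = {1..l + d}"
    using colouring_values[OF c] unfolding B_def R_def by blast
  moreover have "B \<inter> R = {}" and fin: "finite B" "finite R"
    by (auto simp: B_def R_def)
  ultimately have "card B + card R = l + d"
    using card_Un_disjoint[of B R] by simp
  moreover have "card R = l"
    using c by (simp add: colourings_def R_def)
  ultimately have "card B = d"
    by simp
  then have "r - 1 < length (sorted_list_of_set B)"
    using r by auto
  then have "sorted_list_of_set B ! (r - 1) \<in> set (sorted_list_of_set B)"
    by (rule nth_mem)
  then have "black_pos l d c r \<in> B"
    using fin by (simp add: black_pos_def B_def)
  then show "black_pos l d c r \<in> {1..l + d}" "c (black_pos l d c r) = 0"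
    by (auto simp: B_def)
qed

text \<open>Guarantees that the parameter in the quadratic relation at a red entry is one of
  \<open>Q 1\<close>, ..., \<open>Q l\<close>: the partial sum is at least \<open>c r = 1\<close>
  and at most the total number l of red entries.\<close>

lemma red_count:
  assumes c: "c \<in> colourings l d" and r: "r \<in> {1..l + d}" "c r = 1"
  shows "(\<Sum>j=1..r. c j) \<in> {1..l}"
proof -
  have "(\<Sum>j=1..r. c j) \<le> (\<Sum>j=1..l + d. c j)"
    using r by (intro sum_mono2) auto
  also have "\<dots> = (\<Sum>j=1..l + d. if c j = 1 then 1 else 0)"
    using colouring_values[OF c] by (intro sum.cong) auto
  also have "\<dots> = card {i \<in> {1..l + d}. c i = 1}"
    by (simp add: sum.If_cases Int_def)
  also have "\<dots> = l"
    using c by (simp add: colourings_def)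
  finally have "(\<Sum>j=1..r. c j) \<le> l" .
  moreover have "c r \<le> (\<Sum>j=1..r. c j)"
    using r by (intro member_le_sum) auto
  ultimately show ?thesis
    using r by simp
qed

section \<open>Modules over the cyclotomic Hecke algebra\<close>

lemma hecke_gens_simps [simp]:
  "GenE c \<in> hecke_gens l d \<longleftrightarrow> c \<in> colourings l d"
  "GenT r \<in> hecke_gens l d \<longleftrightarrow> r \<in> {1..<l + d}"
  "GenX i \<in> hecke_gens l d \<longleftrightarrow> i \<in> {1..l + d}"
  "GenX' i \<in> hecke_gens l d \<longleftrightarrow> i \<in> {1..l + d}"
  by (auto simp: hecke_gens_def)

text \<open>The relators must lie in the free algebra on the generators for the ideal they generate
  to be well behaved. Only \<open>T_E\<close> needs an argument, as it involves the generator of a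
  swapped colouring.\<close>

lemma hecke_rel_closed:
  assumes "hecke_rel l d q Q p p'"
  shows "p \<in> carrier (free_algebra (hecke_gens l d)) \<and> p' \<in> carrier (free_algebra (hecke_gens l d))"
  using assms
proof cases
  case (T_E c r)
  then show ?thesis
    using swap_in_colourings[of c l d r] by auto
qed (auto simp: power2_eq_square)

text \<open>A representation of the cyclotomic algebra, pulled back to the free algebra. The
  relations become equations between operators, and cosets of cosets disappear from the main
  argument.\<close>

locale cyclotomic_hecke_module =
  finite_dimensional_vector_space scale Basis
  for scale :: "'k::alg_closed_field \<Rightarrow> 'v::ab_group_add \<Rightarrow> 'v" (infixr "*s" 75)
    and Basis :: "'v set" +
  fixes l d :: nat and q :: 'k and Q :: "nat \<Rightarrow> 'k"
    and \<phi> :: "(hgen, 'k) ncpoly \<Rightarrow> 'v \<Rightarrow> 'v"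
  assumes q_nonzero: "q \<noteq> 0"
    and \<phi>_hom: "\<phi> \<in> ring_hom (free_algebra (hecke_gens l d)) (End_algebra scale)"
    and \<phi>_const: "\<phi> (ncconst a) v = a *s v"
    and \<phi>_rel: "hecke_rel l d q Q p p' \<Longrightarrow> \<phi> p = \<phi> p'"
    and \<phi>_cyclotomic: "\<lbrakk>c \<in> colourings l d; 1 \<le> l + d; c 1 = 0\<rbrakk> \<Longrightarrow> \<phi> (hE c) v = 0"
begin

abbreviation FA where "FA \<equiv> carrier (free_algebra (hecke_gens l d)) :: (hgen, 'k) ncpoly set"

abbreviation E where "E c \<equiv> \<phi> (hE c)"
abbreviation T where "T r \<equiv> \<phi> (hT r)"
abbreviation X where "X i \<equiv> \<phi> (hX i)"

lemma \<phi>_linear: "p \<in> FA \<Longrightarrow> Vector_Spaces.linear scale scale (\<phi> p)"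
  using ring_hom_closed[OF \<phi>_hom] by (simp add: End_algebra_def)

lemma \<phi>_vector [simp]:
  assumes "p \<in> FA"
  shows "\<phi> p 0 = 0" "\<phi> p (v + w) = \<phi> p v + \<phi> p w" "\<phi> p (v - w) = \<phi> p v - \<phi> p w"
    "\<phi> p (a *s v) = a *s \<phi> p v" "\<phi> p (\<Sum>i\<in>S. h i) = (\<Sum>i\<in>S. \<phi> p (h i))"
proof -
  interpret p: Vector_Spaces.linear scale scale "\<phi> p"
    using assms by (rule \<phi>_linear)
  show "\<phi> p 0 = 0" "\<phi> p (v + w) = \<phi> p v + \<phi> p w" "\<phi> p (v - w) = \<phi> p v - \<phi> p w"
    "\<phi> p (a *s v) = a *s \<phi> p v" "\<phi> p (\<Sum>i\<in>S. h i) = (\<Sum>i\<in>S. \<phi> p (h i))"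
    by (simp_all add: p.zero p.add p.diff p.scale p.sum)
qed

lemma \<phi>_1 [simp]: "\<phi> 1 v = v"
  using ring_hom_one[OF \<phi>_hom] by (simp add: End_algebra_def)

lemma \<phi>_mult [simp]: "\<lbrakk>p \<in> FA; p' \<in> FA\<rbrakk> \<Longrightarrow> \<phi> (p * p') v = \<phi> p (\<phi> p' v)"
  using ring_hom_mult[OF \<phi>_hom] by (simp add: End_algebra_def)

lemma \<phi>_add [simp]: "\<lbrakk>p \<in> FA; p' \<in> FA\<rbrakk> \<Longrightarrow> \<phi> (p + p') v = \<phi> p v + \<phi> p' v"
  using ring_hom_add[OF \<phi>_hom] by (simp add: End_algebra_def)

lemma \<phi>_diff [simp]: "\<lbrakk>p \<in> FA; p' \<in> FA\<rbrakk> \<Longrightarrow> \<phi> (p - p') v = \<phi> p v - \<phi> p' v"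
  using \<phi>_add[of "p - p'" p' v] by (simp add: algebra_simps del: \<phi>_add)

lemma \<phi>_0 [simp]: "\<phi> 0 v = 0"
  using \<phi>_diff[of 1 1 v] by (simp del: \<phi>_diff)

lemma \<phi>_sum [simp]: "(\<And>i. i \<in> S \<Longrightarrow> P i \<in> FA) \<Longrightarrow> \<phi> (\<Sum>i\<in>S. P i) v = (\<Sum>i\<in>S. \<phi> (P i) v)"
  by (induction S rule: infinite_finite_induct) auto

declare \<phi>_const [simp]

section \<open>The defining relations as identities between operators\<close>

lemma \<phi>_rel_apply: "hecke_rel l d q Q p p' \<Longrightarrow> \<phi> p v = \<phi> p' v"
  by (simp add: \<phi>_rel)

lemma E_E:
  assumes "c \<in> colourings l d" "c' \<in> colourings l d"
  shows "E c (E c' v) = (if c = c' then E c v else 0)"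
  using \<phi>_rel_apply[OF hecke_rel.E_idem, of c v] \<phi>_rel_apply[OF hecke_rel.E_orth, of c c' v] assms
  by (cases "c = c'") simp_all

lemma sum_E: "(\<Sum>c\<in>colourings l d. E c v) = v"
  using \<phi>_rel_apply[OF hecke_rel.E_sum, of v] by simp

lemma X_E:
  assumes "c \<in> colourings l d" "i \<in> {1..l + d}"
  shows "X i (E c v) = E c (X i v)"
  using \<phi>_rel_apply[OF hecke_rel.X_E, of c i v] assms by simp

lemma X_X:
  assumes "i \<in> {1..l + d}" "j \<in> {1..l + d}"
  shows "X i (X j v) = X j (X i v)"
  using \<phi>_rel_apply[OF hecke_rel.X_X, of i j v] assms by simp

lemma T_E:
  assumes "c \<in> colourings l d" "r \<in> {1..<l + d}"
  shows "T r (E c v) = E (swap r c) (T r v)"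
  using \<phi>_rel_apply[OF hecke_rel.T_E, of c r v] assms swap_in_colourings[OF assms] by simp

text \<open>Here and below, \<open>E c v = v\<close> expresses that v lies in e(c)V; the idempotent
  in a relation then drops out when the relation is applied to v.\<close>

lemma TX_red_black:
  assumes "c \<in> colourings l d" "r \<in> {1..<l + d}" "c r = 1" "E c v = v"
  shows "T r (X (Suc r) v) = X r (T r v)"
  using \<phi>_rel_apply[OF hecke_rel.TX_Suc_other, of c r v] assms by simp

lemma TX_black:
  assumes "c \<in> colourings l d" "r \<in> {1..<l + d}" "c r = 0" "c (Suc r) = 0" "E c v = v"
  shows "T r (X (Suc r) v) - X r (T r v) = (q - 1) *s X (Suc r) v"
  using \<phi>_rel_apply[OF hecke_rel.TX_Suc_black, of c r v] assms by simp

lemma T_sq_red_black: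
  assumes "c \<in> colourings l d" "r \<in> {1..<l + d}" "c r = 1" "c (Suc r) = 0" "E c v = v"
  shows "T r (T r v) = X (Suc r) v - Q (\<Sum>j=1..r. c j) *s v"
  using \<phi>_rel_apply[OF hecke_rel.T_sq_red_black, of c r v] assms by (simp add: power2_eq_square)

lemma T_sq_black:
  assumes "c \<in> colourings l d" "r \<in> {1..<l + d}" "c r = 0" "c (Suc r) = 0" "E c v = v"
  shows "T r (T r v) = (q - 1) *s T r v + q *s v"
  using \<phi>_rel_apply[OF hecke_rel.T_sq_black, of c r v] assms by (simp add: power2_eq_square)

section \<open>Eigenvalues of the operators \<open>X i\<close> and of x_r\<close>

abbreviation F where "F \<equiv> {q powi n * Q m | n m. m \<in> {1..l}}"

text \<open>Integer exponents add because q is invertible. The shifts that occur are by 1 and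
  -1.\<close>

lemma F_q_powi_mult:
  assumes "b \<in> F"
  shows "q powi k * b \<in> F"
proof -
  obtain n m where "b = q powi n * Q m" "m \<in> {1..l}"
    using assms by blast
  moreover from this have "q powi k * b = q powi (k + n) * Q m"
    using q_nonzero by (simp add: power_int_add)
  ultimately show ?thesis
    by blast
qed

text \<open>The a-eigenspace of \<open>X j\<close> in e(c)V is stable under \<open>X i\<close>,
  because \<open>X i\<close> commutes with both \<open>X j\<close> and \<open>E c\<close>.\<close>

lemma X_joint_eigenvector:
  assumes c: "c \<in> colourings l d" and i: "i \<in> {1..l + d}" and j: "j \<in> {1..l + d}"
    and v: "E c v = v" "v \<noteq> 0" "X j v = a *s v"
  obtains w b where "E c w = w" "w \<noteq> 0" "X j w = a *s w" "X i w = b *s w"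
proof -
  define W where "W = {w. E c w = w \<and> X j w = a *s w}"
  have "subspace W"
    using c j by (auto simp: W_def subspace_def scale_right_distrib mult.commute)
  moreover have "X i ` W \<subseteq> W"
    using c i j by (auto simp: W_def X_X[OF j i] simp flip: X_E)
  ultimately obtain w b where "w \<in> W" "w \<noteq> 0" "X i w = b *s w"
    using invariant_subspace_eigenvector[OF finite_dimensional_vector_space_axioms \<phi>_linear, of "hX i" W v]
      v i by (auto simp: W_def)
  then show ?thesis
    by (intro that) (auto simp: W_def)
qed

text \<open>Induction step for two adjacent black entries. Here \<open>swap r c = c\<close>, so
  \<open>T r\<close> preserves e(c)V and \<open>IH\<close> is needed only for the same colouring c
  at position r.\<close>

lemma T_black_eigenvalue:
  assumes c: "c \<in> colourings l d" and r: "r \<in> {1..<l + d}" and black: "c r = 0" "c (Suc r) = 0"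
    and v: "E c v = v" "v \<noteq> 0" "X (Suc r) v = a *s v" "X r v = b *s v"
    and IH: "\<And>u t. \<lbrakk>E c u = u; u \<noteq> 0; X r u = t *s u\<rbrakk> \<Longrightarrow> t \<in> F"
  shows "a \<in> F"
proof (cases "a = b")
  case True
  then show ?thesis
    using IH v by blast
next
  case False
  have b: "b \<in> F"
    using IH v by blast
  \<comment> \<open>Since \<open>X r\<close> sends \<open>T r v\<close> to a \<open>T r v\<close> -
    (q - 1) a v and v to b v, the correction by \<open>lam\<close> must satisfy lam b - (q - 1) a =
    lam a.\<close>
  define lam where "lam = (q - 1) * a / (b - a)"
  have lam: "lam * b = lam * a + (q - 1) * a"
    using False by (simp add: lam_def field_simps)
  define w where "w = T r v + lam *s v"
  have XT: "X r (T r v) = a *s T r v - ((q - 1) * a) *s v"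
    using TX_black[OF c r black v(1)] v r by (simp add: algebra_simps)
  have "X r w = a *s T r v - ((q - 1) * a) *s v + (lam * b) *s v"
    using r v by (simp add: w_def XT)
  also have "\<dots> = a *s w"
    unfolding lam w_def by (simp add: scale_left_distrib scale_right_distrib mult.commute)
  finally have Xw: "X r w = a *s w" .
  have Ew: "E c w = w"
    using c v(1) T_E[OF c r, of v] black by (simp add: w_def swap_same)
  show ?thesis
  proof (cases "w = 0")
    case False
    then show ?thesis
      using IH Ew Xw by blast
  next
    case True
    \<comment> \<open>Now \<open>- lam\<close> is an eigenvalue of \<open>T r\<close>, hence a root
      of t^2 - (q - 1) t - q = (t - q)(t + 1).\<close>
    then have T: "T r v = (- lam) *s v"
      by (simp add: w_def eq_neg_iff_add_eq_0)
    have "T r (T r v) = T r ((- lam) *s v)"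
      by (simp only: T)
    also have "\<dots> = (- lam) *s T r v"
      using r by (intro \<phi>_vector(4)) simp
    also have "\<dots> = (lam * lam) *s v"
      by (simp add: T)
    finally have "(lam * lam) *s v = (q - (q - 1) * lam) *s v"
      unfolding T_sq_black[OF c r black v(1)] by (simp add: T algebra_simps)
    then have "lam * lam = q - (q - 1) * lam"
      using v(2) by simp
    then have "(lam - 1) * (lam + q) = 0"
      by (simp add: algebra_simps)
    then consider "lam = 1" | "lam = - q"
      by (auto simp: eq_neg_iff_add_eq_0)
    then show ?thesis
    proof cases
      case 1
      then have "a = b / q"
        using lam q_nonzero by (simp add: field_simps)
      then show ?thesis
        using F_q_powi_mult[OF b, of "-1"] by (simp add: power_int_minus field_simps)
    next
      case 2
      then have "a = q * b"
        using lam by (simp add: algebra_simps)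
      then show ?thesis
        using F_q_powi_mult[OF b, of 1] by simp
    qed
  qed
qed

text \<open>Induction on the position of a black entry. The colouring and the vector vary because
  passing a red entry replaces c by \<open>swap r c\<close> and v by \<open>T r v\<close>.\<close>

lemma X_eigenvalue:
  assumes "c \<in> colourings l d" "i \<in> {1..l + d}" "c i = 0"
    and "E c v = v" "v \<noteq> 0" "X i v = a *s v"
  shows "a \<in> F"
  using assms
proof (induction i arbitrary: c v a)
  case 0
  then show ?case
    by simp
next
  case (Suc r)
  show ?case
  proof (cases "r = 0")
    case True
    \<comment> \<open>A black first entry makes e(c) act as zero, contradicting that v = e(c) v is
      nonzero.\<close>
    then show ?thesis
      using Suc.prems \<phi>_cyclotomic[of c v] by simp
  next
    case False
    then have r: "r \<in> {1..<l + d}" "r \<in> {1..l + d}"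
      using Suc.prems(2) by auto
    note c = Suc.prems(1)
    show ?thesis
    proof (cases "c r = 0")
      case True
      obtain w b where "E c w = w" "w \<noteq> 0" "X (Suc r) w = a *s w" "X r w = b *s w"
        using X_joint_eigenvector[OF c r(2) Suc.prems(2,4-6)] .
      with T_black_eigenvalue[OF c r(1) True Suc.prems(3)] Suc.IH[OF c r(2) True] show ?thesis
        by blast
    next
      case False
      then have red: "c r = 1"
        using colouring_values[OF c r(2)] by simp
      show ?thesis
      proof (cases "T r v = 0")
        case True
        \<comment> \<open>The left-hand side of the quadratic relation vanishes on v, which leaves
          the eigenvalue equation for a parameter.\<close>
        then have "X (Suc r) v = Q (\<Sum>j=1..r. c j) *s v"
          using T_sq_red_black[OF c r(1) red Suc.prems(3,4)] r by simp
        then have "a = q powi 0 * Q (\<Sum>j=1..r. c j)"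
          using Suc.prems by simp
        then show ?thesis
          using red_count[OF c r(2) red] by blast
      next
        case False
        \<comment> \<open>The swap moves the black entry one place to the left, where the induction
          hypothesis applies to \<open>T r v\<close>.\<close>
        have "swap r c \<in> colourings l d"
          using c r(1) by (rule swap_in_colourings)
        moreover have "swap r c r = 0"
          using Suc.prems(3) by (simp add: swap_def)
        moreover have "E (swap r c) (T r v) = T r v"
          using T_E[OF c r(1), of v] Suc.prems(4) by simp
        moreover have "X r (T r v) = a *s T r v"
          using TX_red_black[OF c r(1) red Suc.prems(4)] Suc.prems(6) r by simp
        ultimately show ?thesis
          using Suc.IH r(2) False by blast
      qed
    qed
  qed
qed

text \<open>On e(c)V the element x_r acts as a single \<open>X i\<close>, with i the r-th black
  position of c. Projecting an eigenvector to a nonzero component e(c)v reduces the claim to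
  \<open>X_eigenvalue\<close>.\<close>

lemma x_eigenvalue:
  assumes r: "r \<in> {1..d}" and v: "v \<noteq> 0"
    and xv: "\<phi> (\<Sum>c\<in>colourings l d. hX (black_pos l d c r) * hE c) v = a *s v"
  shows "a \<in> F"
proof -
  obtain c where c: "c \<in> colourings l d" "E c v \<noteq> 0"
    using sum_E[of v] v by (metis (no_types, lifting) sum.neutral)
  define pos where "pos c = black_pos l d c r" for c
  have pos: "pos c' \<in> {1..l + d}" "c' (pos c') = 0" if "c' \<in> colourings l d" for c'
    using black_pos[OF that r] by (simp_all add: pos_def)
  have av: "a *s v = (\<Sum>c'\<in>colourings l d. X (pos c') (E c' v))"
    using pos by (simp flip: xv pos_def)
  have E_c: "hE c \<in> FA"
    using c by simp
  have "a *s E c v = E c (a *s v)"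
    by (simp only: \<phi>_vector(4)[OF E_c])
  also have "\<dots> = (\<Sum>c'\<in>colourings l d. E c (X (pos c') (E c' v)))"
    unfolding av by (rule \<phi>_vector(5)[OF E_c])
  also have "\<dots> = (\<Sum>c'\<in>colourings l d. if c = c' then X (pos c) (E c v) else 0)"
  proof (rule sum.cong)
    fix c' assume c': "c' \<in> colourings l d"
    \<comment> \<open>Moving the projection past \<open>X\<close> brings the two idempotents
      together, and orthogonality leaves only the summand c' = c.\<close>
    have "E c (X (pos c') (E c' v)) = X (pos c') (E c (E c' v))"
      by (rule X_E[OF c(1) pos(1)[OF c'], symmetric])
    then show "E c (X (pos c') (E c' v)) = (if c = c' then X (pos c) (E c v) else 0)"
      using c pos c' by (simp add: E_E)
  qed simp
  also have "\<dots> = X (pos c) (E c v)"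
    using c by simp
  finally show ?thesis
    using X_eigenvalue[OF c(1) pos[OF c(1)], of "E c v" a] c by (simp add: E_E)
qed

end

text \<open>The operators are obtained by composing \<open>\<rho>\<close> with the two coset maps
  from the free algebra to the Hecke algebra and on to its cyclotomic quotient. Relators vanish
  under the first map, the idempotents with black first entry under the second.\<close>

lemma representation_cyclotomic_hecke_module:
  assumes q: "q \<noteq> 0" and fin: "finite_dimensional_vector_space scale Basis"
    and rep: "representation (cyclotomic_hecke_algebra l d q Q) scale \<rho>"
  shows "cyclotomic_hecke_module scale Basis l d q Q (\<lambda>p. \<rho> (cyclotomic_class l d q Q p))"
proof -
  define A where "A = (free_algebra (hecke_gens l d) :: ('a, (hgen, 'a) ncpoly) module)"
  define I where "I = presented_ideal (hecke_gens l d) (hecke_rel l d q Q)"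
  define H where "H = hecke_algebra l d q Q"
  define J where "J = cyclotomic_ideal l d q Q"
  define C where "C = cyclotomic_hecke_algebra l d q Q"
  define cls where "cls = hecke_class l d q Q"
  define \<phi> where "\<phi> p = \<rho> (cyclotomic_class l d q Q p)" for p
  have H: "H = quot_algebra A I" and C: "C = quot_algebra H J"
    by (simp_all add: H_def A_def I_def C_def J_def hecke_algebra_def presented_algebra_def
        cyclotomic_hecke_algebra_def)
  have cls: "cls = (\<lambda>p. I +>\<^bsub>A\<^esub> p)" and \<phi>: "\<phi> = (\<lambda>p. \<rho> (J +>\<^bsub>H\<^esub> cls p))"
    by (simp_all add: fun_eq_iff cls_def hecke_class_def I_def A_def \<phi>_def cyclotomic_class_def
        J_def H_def)
  have algA: "unital_algebra A"
    unfolding A_def by (rule unital_algebra_free_algebra)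
  then interpret A: ring A
    by (simp add: unital_algebra_def)
  have rel_carrier: "{a - b | a b. hecke_rel l d q Q a b} \<subseteq> carrier A"
    unfolding A_def by (auto dest!: hecke_rel_closed)
  have I_eq: "I = genideal A {a - b | a b. hecke_rel l d q Q a b}"
    by (simp add: I_def presented_ideal_def A_def)
  have I: "ideal I A"
    unfolding I_eq by (rule A.genideal_ideal[OF rel_carrier])
  have algH: "unital_algebra H"
    unfolding H by (rule unital_algebra_quot_algebra[OF algA I])
  then interpret H: ring H
    by (simp add: unital_algebra_def)
  have cls_hom: "cls \<in> ring_hom A H"
    unfolding cls H by (rule coset_ring_hom[OF I])
  define Z where "Z = {cls (hE c) | c. c \<in> colourings l d \<and> 1 \<le> l + d \<and> c 1 = 0}"
  have hE: "hE c \<in> carrier A" if "c \<in> colourings l d" for c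
    using that by (simp add: A_def)
  have Z: "Z \<subseteq> carrier H"
    using ring_hom_closed[OF cls_hom hE] by (auto simp: Z_def)
  have J_eq: "J = genideal H Z"
    by (simp add: J_def cyclotomic_ideal_def H_def Z_def cls_def)
  have J: "ideal J H"
    unfolding J_eq by (rule H.genideal_ideal[OF Z])
  have J_hom: "(\<lambda>x. J +>\<^bsub>H\<^esub> x) \<in> ring_hom H C"
    unfolding C by (rule coset_ring_hom[OF J])
  have \<rho>_hom: "\<rho> \<in> ring_hom C (End_algebra scale)"
    and \<rho>_smult: "\<And>a x. x \<in> carrier C \<Longrightarrow> \<rho> (a \<odot>\<^bsub>C\<^esub> x) = a \<odot>\<^bsub>End_algebra scale\<^esub> \<rho> x"
    using rep by (simp_all add: representation_def C_def)
  have \<phi>_hom: "\<phi> \<in> ring_hom A (End_algebra scale)"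
    using ring_hom_trans[OF ring_hom_trans[OF cls_hom J_hom] \<rho>_hom] by (simp add: \<phi> comp_def)
  have \<phi>_add: "\<phi> (p + p') v = \<phi> p v + \<phi> p' v" if "p \<in> carrier A" "p' \<in> carrier A" for p p' v
    using ring_hom_add[OF \<phi>_hom that] by (simp add: A_def End_algebra_def)
  have \<phi>_0: "\<phi> 0 v = 0" for v
    \<comment> \<open>Cancel in \<open>\<phi> 0 v = \<phi> 0 v + \<phi> 0 v\<close>.\<close>
    using \<phi>_add[of 0 0 v] by (simp add: A_def)
  have \<phi>_I: "\<phi> p v = 0" if "p \<in> I" for p v
    using coset_eq_zero_coset[OF I that] \<phi>_0[of v] by (simp add: \<phi> cls A_def)
  have \<phi>_const: "\<phi> (ncconst a) v = scale a v" for a v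
  proof -
    \<comment> \<open>A constant is a scalar multiple of the unit; this form survives both quotients
      and then \<open>\<rho>\<close>, which is compatible with scalars.\<close>
    have "cls (ncconst a) = a \<odot>\<^bsub>H\<^esub> cls \<one>\<^bsub>A\<^esub>"
      unfolding H cls quot_algebra_smult_coset[OF algA I A.one_closed] by (simp add: A_def)
    also have "cls \<one>\<^bsub>A\<^esub> = \<one>\<^bsub>H\<^esub>"
      by (rule ring_hom_one[OF cls_hom])
    finally have "J +>\<^bsub>H\<^esub> cls (ncconst a) = a \<odot>\<^bsub>C\<^esub> (J +>\<^bsub>H\<^esub> \<one>\<^bsub>H\<^esub>)"
      unfolding C by (simp only: quot_algebra_smult_coset[OF algH J H.one_closed])
    then have "\<phi> (ncconst a) = a \<odot>\<^bsub>End_algebra scale\<^esub> \<rho> (J +>\<^bsub>H\<^esub> \<one>\<^bsub>H\<^esub>)"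
      using \<rho>_smult[OF ring_hom_closed[OF J_hom H.one_closed]] by (simp add: \<phi>)
    also have "\<rho> (J +>\<^bsub>H\<^esub> \<one>\<^bsub>H\<^esub>) = \<one>\<^bsub>End_algebra scale\<^esub>"
      using ring_hom_one[OF J_hom] ring_hom_one[OF \<rho>_hom] by simp
    finally show ?thesis
      by (simp add: End_algebra_def)
  qed
  have \<phi>_rel: "\<phi> p = \<phi> p'" if rel: "hecke_rel l d q Q p p'" for p p'
  proof
    fix v
    have mem: "p - p' \<in> I"
      using A.genideal_self[OF rel_carrier] rel by (auto simp: I_eq)
    have "p - p' \<in> carrier A" "p' \<in> carrier A"
      using hecke_rel_closed[OF rel] by (simp_all add: A_def)
    then show "\<phi> p v = \<phi> p' v"
      using \<phi>_add[of "p - p'" p' v] \<phi>_I[OF mem] by simp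
  qed
  have \<phi>_cyclotomic: "\<phi> (hE c) v = 0" if "c \<in> colourings l d" "1 \<le> l + d" "c 1 = 0" for c v
  proof -
    have "cls (hE c) \<in> J"
      using H.genideal_self[OF Z] that by (auto simp: J_eq Z_def)
    \<comment> \<open>With the classes of e(c) and of 0 both in J, their cosets both equal the zero
      coset.\<close>
    moreover have "cls 0 \<in> J"
    proof -
      have "cls 0 = \<zero>\<^bsub>H\<^esub>"
        using ring_hom_zero[OF cls_hom A.ring_axioms H.ring_axioms] by (simp add: A_def)
      then show ?thesis
        using additive_subgroup.zero_closed[OF ideal.axioms(1)[OF J]] by simp
    qed
    ultimately have "\<phi> (hE c) = \<phi> 0"
      by (simp add: \<phi> coset_eq_zero_coset[OF J])
    then show ?thesis
      by (simp add: \<phi>_0)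
  qed
  have "cyclotomic_hecke_module scale Basis l d q Q \<phi>"
    using fin q \<phi>_hom \<phi>_const \<phi>_rel \<phi>_cyclotomic
    by (intro cyclotomic_hecke_module.intro cyclotomic_hecke_module_axioms.intro) (simp_all add: A_def)
  then show ?thesis
    by (simp add: \<phi>_def[abs_def])
qed

theorem corollary5p3:
  fixes l d r :: nat
    and q :: "'k::alg_closed_field"
    and Q :: "nat \<Rightarrow> 'k"
    and scale :: "'k \<Rightarrow> 'v::ab_group_add \<Rightarrow> 'v"
    and Basis :: "'v set"
    and \<rho> :: "(hgen, 'k) ncpoly set set \<Rightarrow> 'v \<Rightarrow> 'v"
  assumes "q \<noteq> 0" and "q \<noteq> 1"
    and "\<And>m. m \<in> {1..l} \<Longrightarrow> Q m \<noteq> 0"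
    and "finite_dimensional_vector_space scale Basis"
    and "representation (cyclotomic_hecke_algebra l d q Q) scale \<rho>"
    and "r \<in> {1..d}"
  shows "{a. eigenvalue scale (\<rho> (cyclotomic_x l d q Q r)) a}
    \<subseteq> {q powi n * Q m | n m. m \<in> {1..l}}"
proof
  interpret cyclotomic_hecke_module scale Basis l d q Q "\<lambda>p. \<rho> (cyclotomic_class l d q Q p)"
    using assms(1,4,5) by (rule representation_cyclotomic_hecke_module)
  fix a assume "a \<in> {a. eigenvalue scale (\<rho> (cyclotomic_x l d q Q r)) a}"
  \<comment> \<open>Unfolding \<open>cyclotomic_x\<close> exhibits its action as the operator of the
    locale attached to the sum in \<open>x_eigenvalue\<close>.\<close>
  then show "a \<in> {q powi n * Q m | n m. m \<in> {1..l}}"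
    using x_eigenvalue[OF assms(6)] by (auto simp: eigenvalue_def cyclotomic_x_def)
qed

end
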